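(* Consider an $N$-agent static team problem such that: (a) for each fixed $x\in\mathsf X$ the map $(\mathbf y,\mathbf u)\mapsto c(x,\mathbf y,\mathbf u)$ is continuous, and $c$ is bounded on every compact subset of $\mathsf X\times\mathsf Y\times\mathsf U$; (b) each $\mathsf U^i$ is a closed and convex subset of a completely metrizable locally convex vector space; (c) each $\mathsf Y^i$ is locally compact; (d) for every compact $G\subset\mathsf U$ of the form $G=\prod_{i=1}^NG^i$, the function $w_G(x,\mathbf y):=\sup_{\mathbf u\in G}c(x,\mathbf y,\mathbf u)$ is integrable with respect to $\mathbb P(dx,d\mathbf y)$; (e) for every $\underline\gamma\in\mathbf\Gamma$ with $J(\underline\gamma)<\infty$ and each $i$, there exists $u^{i,*}\in\mathsf U^i$ such that $J(\underline\gamma^{-i},\gamma^i_{u^{i,*}})<\infty$, where $\gamma^i_{u^{i,*}}\equiv u^{i,*}$ and $(\underline\gamma^{-i},\gamma^i_{u^{i,*}})$ is $\underline\gamma$ with its $i$-th component replaced by $\gamma^i_{u^{i,*}}$; (f) for every compact $G=\prod_{i=1}^NG^i\subset\mathsf U$, $\lim_{R\to\infty}\sup_{l,n}\int_{\{w_G>R\}}w_G\,d\mathbb P_{l,n}=0$. Then for each $(l,n)$ and any $\varepsilon>0$ there exist finite sets $\mathsf U_\varepsilon^i\subset\mathsf U^i$, $i=1,\dots,N$, such that $$\inf_{\underline\pi\in\mathbf\Pi_{l,n}^\varepsilon}J_{l,n}(\underline\pi)<J_{l,n}^*+\varepsilon,$$ where $\mathbf\Pi_{l,n}^\varepsilon:=\{\underline\pi\in\mathbf\Pi_{l,n}:\pi^i(\mathsf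 Z_{l,n}^i)\subset\mathsf U_\varepsilon^i,\ i=1,\dots,N\}$ and $J_{l,n}^*:=\inf_{\underline\pi\in\mathbf\Pi_{l,n}}J_{l,n}(\underline\pi)$.
   Context: Static team problem: a Borel space is a Borel subset of a complete separable metric space, with its Borel $\sigma$-algebra. $\mathsf X$ is a Borel space with a probability measure $\mathbb P$; for $i=1,\dots,N$ the observation space $\mathsf Y^i$ (with metric $d_i$) and the action space $\mathsf U^i$ are Borel spaces, and $W^i(\cdot|x)$ is a stochastic kernel on $\mathsf Y^i$ given $\mathsf X$. Put $\mathsf Y=\prod_i\mathsf Y^i$, $\mathsf U=\prod_i\mathsf U^i$, and $\mathbb P(dx,d\mathbf y)=\mathbb P(dx)\prod_{i=1}^N W^i(dy^i|x)$. The cost $c:\mathsf X\times\mathsf Y\times\mathsf U\to[0,\infty)$ is Borel measurable. $\Gamma^i$ is the set of measurable maps $\gamma^i:\mathsf Y^i\to\mathsf U^i$, $\mathbf\Gamma=\prod_i\Gamma^i$, $\underline\gamma(\mathbf y)=(\gamma^1(y^1),\dots,\gamma^N(y^N))$, $J(\underline\gamma)=\int c(x,\mathbf y,\underline\gamma(\mathbf y))\,\mathbb P(dx,d\mathbf y)\in[0,\infty]$. Quantizers: for each $i$, $(\mathsf K_l^i)_{l\ge1}$ is a sequence of compact sets with $\mathsf K_l^i\subset\operatorname{int}\mathsf K_{l+1}^i$ and $\mathsf Y^i=\bigcup_l\mathsf K_l^i$. For each $l,n\ge1$, $\mathsf Y_{l,n}^i\subset\mathsf K_l^i$ is a finite $1/n$-net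 in $\mathsf K_l^i$ (i.e. $\min_{z\in\mathsf Y_{l,n}^i}d_i(y,z)<1/n$ for all $y\in\mathsf K_l^i$). Fix $y_{i,0}\in\mathsf Y^i$; $Q_{l,n}^i(y)=\arg\min_{z\in\mathsf Y_{l,n}^i}d_i(y,z)$ (ties broken measurably) for $y\in\mathsf K_l^i$ and $Q_{l,n}^i(y)=y_{i,0}$ otherwise. Finite observation model: $\mathsf Z_{l,n}^i=\{y_{i,0}\}\cup\mathsf Y_{l,n}^i$, $\mathsf Z_{l,n}=\prod_i\mathsf Z_{l,n}^i$, $W_{l,n}^i(\cdot|x)=\sum_{z\in\mathsf Z_{l,n}^i}W^i(\{y:Q_{l,n}^i(y)=z\}|x)\,\delta_z(\cdot)$, $\mathbb P_{l,n}(dx,d\mathbf y)=\mathbb P(dx)\prod_iW_{l,n}^i(dy^i|x)$ (also viewed as a measure on $\mathsf X\times\mathsf Y$), $\mathbf\Pi_{l,n}=\prod_i\{\pi^i:\mathsf Z_{l,n}^i\to\mathsf U^i\}$, $J_{l,n}(\underline\pi)=\int_{\mathsf X\times\mathsf Z_{l,n}}c(x,\mathbf y,\underline\pi(\mathbf y))\,\mathbb P_{l,n}(dx,d\mathbf y)$. *)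

theory Defs
  imports "HOL-Probability.Probability"
begin

definition locally_convex_tvs :: "'a::{real_vector, topological_ab_group_add} itself \<Rightarrow> bool" where
  "locally_convex_tvs _ \<longleftrightarrow>
     continuous_on UNIV (\<lambda>(r :: real, x :: 'a). r *\<^sub>R x) \<and>
     (\<forall>V :: 'a set. open V \<and> 0 \<in> V \<longrightarrow> (\<exists>C. open C \<and> convex C \<and> 0 \<in> C \<and> C \<subseteq> V))"

text \<open>
  Agents are the elements of a finite index type \<open>'i\<close>. The spaces of the different agents are
  subsets of one common type; this loses no generality, because finitely many Polish spaces are
  closed subsets of their disjoint union, and finitely many completely metrizable locally convex
  spaces are closed subspaces of their product. Metrics on the observation spaces are
  agent-specific.

  A subset of a topological space carries the subspace topology, so its Borel sigma-algebra is
  the trace of \<^const>\<open>borel\<close>.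
\<close>

abbreviation borel_on :: "'a::topological_space set \<Rightarrow> 'a measure" where
  "borel_on S \<equiv> restrict_space borel S"

abbreviation set_product :: "('i \<Rightarrow> 'a set) \<Rightarrow> ('i \<Rightarrow> 'a) set" where
  "set_product A \<equiv> (\<Pi>\<^sub>E i\<in>UNIV. A i)"

definition stochastic_kernel ::
    "'x measure \<Rightarrow> 'y::topological_space set \<Rightarrow> ('x \<Rightarrow> 'y measure) \<Rightarrow> bool" where
  "stochastic_kernel P Y V \<longleftrightarrow> V \<in> P \<rightarrow>\<^sub>M prob_algebra (borel_on Y)"

text \<open>The law \<open>P(dx) \<Prod>\<^sub>i V\<^sup>i(dy\<^sup>i|x)\<close> on the product of the state and the observation spaces.\<close>

definition joint_law ::
    "'x measure \<Rightarrow> ('i::finite \<Rightarrow> 'y::topological_space set) \<Rightarrow> ('i \<Rightarrow> 'x \<Rightarrow> 'y measure)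
      \<Rightarrow> ('x \<times> ('i \<Rightarrow> 'y)) measure" where
  "joint_law P Y V =
     P \<bind> (\<lambda>x. distr (\<Pi>\<^sub>M i\<in>UNIV. V i x) (P \<Otimes>\<^sub>M (\<Pi>\<^sub>M i\<in>UNIV. borel_on (Y i))) (\<lambda>y. (x, y)))"

definition policies ::
    "('i \<Rightarrow> 'y::topological_space set) \<Rightarrow> ('i \<Rightarrow> 'u::topological_space set)
      \<Rightarrow> ('i \<Rightarrow> 'y \<Rightarrow> 'u) set" where
  "policies Y U = {\<gamma>. \<forall>i. \<gamma> i \<in> borel_on (Y i) \<rightarrow>\<^sub>M borel_on (U i)}"

definition team_cost ::
    "('x \<times> ('i \<Rightarrow> 'y)) measure \<Rightarrow> ('x \<times> ('i \<Rightarrow> 'y) \<times> ('i \<Rightarrow> 'u) \<Rightarrow> real)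
      \<Rightarrow> ('i \<Rightarrow> 'y \<Rightarrow> 'u) \<Rightarrow> ennreal" where
  "team_cost M c \<gamma> = (\<integral>\<^sup>+(x, y). ennreal (c (x, y, \<lambda>i. \<gamma> i (y i))) \<partial>M)"

definition worst_cost ::
    "('x \<times> ('i \<Rightarrow> 'y) \<times> ('i \<Rightarrow> 'u) \<Rightarrow> real) \<Rightarrow> ('i \<Rightarrow> 'u) set \<Rightarrow> 'x \<times> ('i \<Rightarrow> 'y) \<Rightarrow> real" where
  "worst_cost c G = (\<lambda>(x, y). SUP u\<in>G. c (x, y, u))"

text \<open>In the following the indices \<open>l\<close> and \<open>n\<close> range over the positive integers.
  Interiors are taken in \<open>Y\<close>, not in the ambient type.\<close>

definition compact_exhaustion :: "'y::topological_space set \<Rightarrow> (nat \<Rightarrow> 'y set) \<Rightarrow> bool" where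
  "compact_exhaustion Y K \<longleftrightarrow>
     (\<forall>l\<ge>1. compact (K l) \<and> K l \<subseteq> Y \<and> K l \<subseteq> (top_of_set Y) interior_of (K (Suc l))) \<and>
     Y = (\<Union>l\<in>{1..}. K l)"

definition finite_net :: "('y \<Rightarrow> 'y \<Rightarrow> real) \<Rightarrow> real \<Rightarrow> 'y set \<Rightarrow> 'y set \<Rightarrow> bool" where
  "finite_net d r K F \<longleftrightarrow> finite F \<and> F \<subseteq> K \<and> (\<forall>y\<in>K. \<exists>z\<in>F. d y z < r)"

text \<open>A measurable selection \<open>Q\<close> of the nearest point of \<open>F\<close> on \<open>K\<close>, constant outside \<open>K\<close>.\<close>

definition quantizer ::
    "('y \<Rightarrow> 'y \<Rightarrow> real) \<Rightarrow> 'y::topological_space set \<Rightarrow> 'y set \<Rightarrow> 'y set \<Rightarrow> 'y \<Rightarrow> ('y \<Rightarrow> 'y) \<Rightarrow> bool"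
  where
  "quantizer d Y K F y0 Q \<longleftrightarrow>
     Q \<in> borel_on Y \<rightarrow>\<^sub>M borel_on Y \<and>
     (\<forall>y\<in>K. is_arg_min (d y) (\<lambda>z. z \<in> F) (Q y)) \<and>
     (\<forall>y\<in>Y - K. Q y = y0)"

text \<open>The kernel \<open>\<Sum>\<^sub>z\<^sub>\<in>\<^sub>Z V({y. Q y = z}|x) \<delta>\<^sub>z\<close>, as a kernel on all of \<open>Y\<close> (it is carried by \<open>Z\<close>).\<close>

definition quantized_kernel ::
    "'y::topological_space set \<Rightarrow> 'y set \<Rightarrow> ('y \<Rightarrow> 'y) \<Rightarrow> ('x \<Rightarrow> 'y measure) \<Rightarrow> 'x \<Rightarrow> 'y measure"
  where
  "quantized_kernel Y Z Q V x =
     measure_of Y (sets (borel_on Y))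
       (\<lambda>A. \<Sum>z\<in>Z. emeasure (V x) {y \<in> Y. Q y = z} * indicator A z)"

definition finite_policies :: "('i \<Rightarrow> 'y set) \<Rightarrow> ('i \<Rightarrow> 'u set) \<Rightarrow> ('i \<Rightarrow> 'y \<Rightarrow> 'u) set" where
  "finite_policies Z U = {\<pi>. \<forall>i. \<pi> i \<in> Z i \<rightarrow>\<^sub>E U i}"

text \<open>The integral is restricted to \<open>X \<times> \<Prod>\<^sub>i Z\<^sup>i\<close>, since policies in \<^const>\<open>finite_policies\<close>
  are unspecified outside of \<open>Z\<^sup>i\<close>.\<close>

definition finite_team_cost ::
    "'x set \<Rightarrow> ('i \<Rightarrow> 'y set) \<Rightarrow> ('x \<times> ('i \<Rightarrow> 'y)) measure
      \<Rightarrow> ('x \<times> ('i \<Rightarrow> 'y) \<times> ('i \<Rightarrow> 'u) \<Rightarrow> real) \<Rightarrow> ('i \<Rightarrow> 'y \<Rightarrow> 'u) \<Rightarrow> ennreal" where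
  "finite_team_cost X Z M c \<pi> =
     (\<integral>\<^sup>+p\<in>X \<times> set_product Z. ennreal (c (fst p, snd p, \<lambda>i. \<pi> i (snd p i))) \<partial>M)"

end

theory Submission
  imports Defs
begin

text \<open>
  A policy on the finite set \<open>Z\<^sup>i\<close> has finite range, so the ranges of a near-optimal policy are
  suitable finite action sets, provided that the optimal cost is finite. For this, (f) is applied
  to a one-point set of actions: it makes the cost of the corresponding constant policy finite.
\<close>

text \<open>By \<open>emeasure_measure_of_conv\<close>, the value of \<open>distr\<close> at
  \<open>A\<close> is either the measure of a preimage inside \<open>space M\<close> or 0, so the
  bound covers every function \<open>f\<close>.\<close>

lemma emeasure_distr_space_le:
  "emeasure (distr M N f) A \<le> emeasure M (space M)"
  by (auto simp: distr_def emeasure_measure_of_conv intro: emeasure_space)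

text \<open>If \<open>f\<close> is not measurable, then \<^const>\<open>distr\<close> in the definition of \<^const>\<open>bind\<close> is junk, but
  its mass is still at most that of \<open>M\<close>.\<close>

lemma emeasure_bind_le:
  fixes f :: "'a \<Rightarrow> 'b measure"
  shows "emeasure (M \<bind> f) A \<le> emeasure M (space M)"
\<comment> \<open>Over an empty space \<open>bind\<close> is the measure on the empty set. In either
  excluded case the left side is 0.\<close>
proof (cases "space M = {} \<or> A \<notin> sets (M \<bind> f)")
  case True
  then have "A = {} \<or> A \<notin> sets (M \<bind> f)"
    by (auto simp: bind_empty)
  then show ?thesis
    by (auto simp: emeasure_notin_sets)
next
  case False
  \<comment> \<open>This is the representative that the definition of \<open>bind\<close> uses to
    fix the target sigma-algebra.\<close>
  define N where "N = f (SOME x. x \<in> space M)"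
  define D where "D = distr M (subprob_algebra N) f"
  have bind: "M \<bind> f = join D"
    using False by (simp add: bind_def N_def D_def)
  have "A \<in> sets N"
    using False by (auto simp: bind D_def)
  then have "emeasure (M \<bind> f) A = (\<integral>\<^sup>+N'. emeasure N' A \<partial>D)"
    unfolding bind by (intro emeasure_join) (simp_all add: D_def)
  \<comment> \<open>The space of \<open>D\<close> is that of \<open>subprob_algebra N\<close>
    whatever \<open>f\<close> is, so each \<open>N'\<close> has mass at most 1.\<close>
  also have "\<dots> \<le> (\<integral>\<^sup>+N'. 1 \<partial>D)"
    by (intro nn_integral_mono)
      (auto simp: D_def space_subprob_algebra intro: subprob_space.subprob_emeasure_le_1)
  also have "\<dots> \<le> emeasure M (space M)"
    by (simp add: D_def emeasure_distr_space_le)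
  finally show ?thesis .
qed

text \<open>Splitting the simple functions below \<open>f\<close> instead of \<open>f\<close> avoids measurability of \<open>f\<close>.\<close>

lemma nn_integral_le_tail:
  fixes f :: "'a \<Rightarrow> ennreal"
  shows "(\<integral>\<^sup>+x. f x \<partial>M) \<le> r * emeasure M (space M) + (\<integral>\<^sup>+x\<in>{x. r < f x}. f x \<partial>M)"
proof (subst nn_integral_def, rule SUP_least, clarify)
  fix g assume g: "simple_function M g" "g \<le> f"
  then have [measurable]: "g \<in> borel_measurable M"
    by (auto intro: borel_measurable_simple_function)
  have "integral\<^sup>S M g = (\<integral>\<^sup>+x. g x \<partial>M)"
    using g by (simp add: nn_integral_eq_simple_integral)
  \<comment> \<open>Where \<open>g\<close> is at most \<open>r\<close> the first summand suffices,
    elsewhere the second. The set cut out by \<open>g\<close> is measurable because \<open>g\<close>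
    is simple.\<close>
  also have "\<dots> \<le> (\<integral>\<^sup>+x. r + g x * indicator {x\<in>space M. r < g x} x \<partial>M)"
    by (intro nn_integral_mono) (auto simp: indicator_def not_less)
  also have "\<dots> = r * emeasure M (space M) + (\<integral>\<^sup>+x\<in>{x\<in>space M. r < g x}. g x \<partial>M)"
    by (subst nn_integral_add) auto
  also have "\<dots> \<le> r * emeasure M (space M) + (\<integral>\<^sup>+x\<in>{x. r < f x}. f x \<partial>M)"
    using g(2) by (intro add_left_mono nn_integral_mono)
      (auto simp: le_fun_def indicator_def intro: less_le_trans)
  finally show "integral\<^sup>S M g \<le> r * emeasure M (space M) + (\<integral>\<^sup>+x\<in>{x. r < f x}. f x \<partial>M)" .
qed

theorem theorem11:
  fixes X :: "'x::polish_space set"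
    and P :: "'x measure"
    and Y :: "'i::finite \<Rightarrow> 'y::polish_space set"
    and d :: "'i \<Rightarrow> 'y \<Rightarrow> 'y \<Rightarrow> real"
    and U :: "'i \<Rightarrow> 'u::{real_vector, topological_ab_group_add} set"
    and W :: "'i \<Rightarrow> 'x \<Rightarrow> 'y measure"
    and c :: "'x \<times> ('i \<Rightarrow> 'y) \<times> ('i \<Rightarrow> 'u) \<Rightarrow> real"
    and K :: "'i \<Rightarrow> nat \<Rightarrow> 'y set"
    and F :: "'i \<Rightarrow> nat \<Rightarrow> nat \<Rightarrow> 'y set"
    and y0 :: "'i \<Rightarrow> 'y"
    and Q :: "'i \<Rightarrow> nat \<Rightarrow> nat \<Rightarrow> 'y \<Rightarrow> 'y"
    and l n :: nat
    and \<epsilon> :: real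
  defines "Z \<equiv> \<lambda>l n i. insert (y0 i) (F i l n)"
  defines "M \<equiv> joint_law P Y W"
  defines "M' \<equiv> \<lambda>l n. joint_law P Y (\<lambda>i. quantized_kernel (Y i) (Z l n i) (Q i l n) (W i))"
  defines "J \<equiv> team_cost M c"
  defines "J' \<equiv> \<lambda>l n. finite_team_cost X (Z l n) (M' l n) c"
  defines "\<G> \<equiv> {G. \<exists>H. G = set_product H \<and> compact G \<and> G \<subseteq> set_product U}"
  assumes X_borel: "X \<in> sets borel"
    and P_prob: "prob_space P" "sets P = sets (borel_on X)"
    and Y_borel: "\<And>i. Y i \<in> sets borel"
    and Y_metric: "\<And>i. Metric_space (Y i) (d i)"
      "\<And>i. Metric_space.mtopology (Y i) (d i) = top_of_set (Y i)"
    and U_borel: "\<And>i. \<exists>B :: 'p::polish_space set. B \<in> sets borel \<and> U i homeomorphic B"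
    and U_nonempty: "\<And>i. U i \<noteq> {}"
    and W_kernel: "\<And>i. stochastic_kernel P (Y i) (W i)"
    and c_measurable: "c \<in> borel_measurable (borel_on (X \<times> set_product Y \<times> set_product U))"
    and c_nonneg: "\<And>p. p \<in> X \<times> set_product Y \<times> set_product U \<Longrightarrow> 0 \<le> c p"
    and K_exhaustion: "\<And>i. compact_exhaustion (Y i) (K i)"
    and F_net: "\<And>i l n. 1 \<le> l \<Longrightarrow> 1 \<le> n \<Longrightarrow> finite_net (d i) (1 / real n) (K i l) (F i l n)"
    and y0_in: "\<And>i. y0 i \<in> Y i"
    and Q_quantizer: "\<And>i l n. 1 \<le> l \<Longrightarrow> 1 \<le> n \<Longrightarrow>
      quantizer (d i) (Y i) (K i l) (F i l n) (y0 i) (Q i l n)"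
    and a_continuous: "\<And>x. x \<in> X \<Longrightarrow>
      continuous_on (set_product Y \<times> set_product U) (\<lambda>(y, u). c (x, y, u))"
    and a_bounded: "\<And>C. compact C \<Longrightarrow> C \<subseteq> X \<times> set_product Y \<times> set_product U \<Longrightarrow> bounded (c ` C)"
    and b_ambient: "locally_convex_tvs TYPE('u)" "completely_metrizable_space (euclidean :: 'u topology)"
    and b_closed_convex: "\<And>i. closed (U i)" "\<And>i. convex (U i)"
    and c_locally_compact: "\<And>i. locally compact (Y i)"
    and d_integrable: "\<And>G. G \<in> \<G> \<Longrightarrow> integrable M (worst_cost c G)"
    and e_finite: "\<And>\<gamma> i. \<gamma> \<in> policies Y U \<Longrightarrow> J \<gamma> < \<infinity> \<Longrightarrow> \<exists>u\<in>U i. J (\<gamma>(i := (\<lambda>_. u))) < \<infinity>"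
    and f_uniform: "\<And>G. G \<in> \<G> \<Longrightarrow>
      ((\<lambda>R. SUP l\<in>{1..}. SUP n\<in>{1..}.
          \<integral>\<^sup>+p\<in>{p. worst_cost c G p > R}. ennreal (worst_cost c G p) \<partial>M' l n) \<longlongrightarrow> 0) at_top"
    and l_n: "1 \<le> l" "1 \<le> n"
    and \<epsilon>_pos: "0 < \<epsilon>"
  shows "\<exists>U\<epsilon> :: 'i \<Rightarrow> 'u set. (\<forall>i. finite (U\<epsilon> i) \<and> U\<epsilon> i \<subseteq> U i) \<and>
    (INF \<pi>\<in>{\<pi> \<in> finite_policies (Z l n) U. \<forall>i. \<pi> i ` Z l n i \<subseteq> U\<epsilon> i}. J' l n \<pi>)
      < (INF \<pi>\<in>finite_policies (Z l n) U. J' l n \<pi>) + ennreal \<epsilon>"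
proof -
  \<comment> \<open>Finiteness matters: in \<open>ennreal\<close> adding to infinity gives no strict
    increase.\<close>
  have less_add: "a < a + ennreal \<epsilon>" if "a < \<infinity>" for a :: ennreal
    using that \<epsilon>_pos ennreal_add_left_cancel_less[of a 0 "ennreal \<epsilon>"] by simp
  have finite_Z: "finite (Z l n i)" for i
    using F_net[OF l_n] by (simp add: Z_def finite_net_def)
  define u0 where "u0 = (\<lambda>i. SOME u. u \<in> U i)"
  have u0: "u0 i \<in> U i" for i
    unfolding u0_def using U_nonempty by (simp add: some_in_eq)
  define w where "w = worst_cost c {u0}"
  have w: "w p = c (fst p, snd p, u0)" for p
    by (simp add: w_def worst_cost_def case_prod_beta)
  have "{u0} = set_product (\<lambda>i. {u0 i})"
    by (auto simp: PiE_def)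
  moreover have "{u0} \<subseteq> set_product U"
    using u0 by (simp add: PiE_UNIV_domain)
  ultimately have G: "{u0} \<in> \<G>"
    unfolding \<G>_def mem_Collect_eq by (meson compact_sing)
  \<comment> \<open>The bound 1 is arbitrary: any finite bound on the tail would do.\<close>
  obtain R where
    "(SUP l\<in>{1..}. SUP n\<in>{1..}. \<integral>\<^sup>+p\<in>{p. w p > R}. ennreal (w p) \<partial>M' l n) < 1"
    using eventually_happens'[OF _ order_tendstoD(2)[OF f_uniform[OF G], of 1]]
    by (auto simp: w_def)
  moreover have "(\<integral>\<^sup>+p\<in>{p. w p > R}. ennreal (w p) \<partial>M' l n) \<le>
      (SUP l\<in>{1..}. SUP n\<in>{1..}. \<integral>\<^sup>+p\<in>{p. w p > R}. ennreal (w p) \<partial>M' l n)"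
    using l_n by (intro SUP_upper2[of l] SUP_upper2[of n]) auto
  ultimately have tail: "(\<integral>\<^sup>+p\<in>{p. w p > R}. ennreal (w p) \<partial>M' l n) < 1"
    by simp
  \<comment> \<open>Only an upper bound on the total mass is used, so the quantized kernels need not
    be shown measurable in the state.\<close>
  have M'_le: "emeasure (M' l n) (space (M' l n)) \<le> 1"
    unfolding M'_def joint_law_def prob_space.emeasure_space_1[OF P_prob(1), symmetric]
    by (rule emeasure_bind_le)
  define \<pi>0 where "\<pi>0 = (\<lambda>i. \<lambda>y\<in>Z l n i. u0 i)"
  have \<pi>0: "\<pi>0 \<in> finite_policies (Z l n) U"
    using u0 by (auto simp: \<pi>0_def finite_policies_def)
  \<comment> \<open>Outside \<open>Z l n i\<close> the policy is \<open>undefined\<close>, but the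
    cost integral sees only the product of these sets.\<close>
  have "(\<lambda>i. \<pi>0 i (y i)) = u0" if "y \<in> set_product (Z l n)" for y
    using that by (auto simp: \<pi>0_def PiE_iff)
  then have "J' l n \<pi>0 \<le> (\<integral>\<^sup>+p. ennreal (w p) \<partial>M' l n)"
    unfolding J'_def finite_team_cost_def w
    by (intro nn_integral_mono) (auto simp: indicator_def)
  also have "\<dots> \<le> ennreal R * emeasure (M' l n) (space (M' l n)) +
      (\<integral>\<^sup>+p\<in>{p. ennreal R < ennreal (w p)}. ennreal (w p) \<partial>M' l n)"
    by (rule nn_integral_le_tail)
  \<comment> \<open>The inclusion of the tail sets holds for negative \<open>R\<close> too: then
    \<open>ennreal R\<close> is 0, and a positive \<open>w p\<close> exceeds
    \<open>R\<close>.\<close>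
  also have "\<dots> \<le> ennreal R * 1 + (\<integral>\<^sup>+p\<in>{p. w p > R}. ennreal (w p) \<partial>M' l n)"
    using M'_le by (intro add_mono mult_left_mono nn_integral_mono)
      (auto simp: indicator_def dest: leD[OF ennreal_leI, rotated] simp flip: not_le)
  also have "\<dots> < \<infinity>"
    using tail by (auto simp: less_top[symmetric])
  finally have "(INF \<pi>\<in>finite_policies (Z l n) U. J' l n \<pi>) < \<infinity>"
    using \<pi>0 by (auto simp: INF_less_iff)
  then have "(INF \<pi>\<in>finite_policies (Z l n) U. J' l n \<pi>)
      < (INF \<pi>\<in>finite_policies (Z l n) U. J' l n \<pi>) + ennreal \<epsilon>"
    by (rule less_add)
  then obtain \<pi> where \<pi>: "\<pi> \<in> finite_policies (Z l n) U"
    "J' l n \<pi> < (INF \<pi>\<in>finite_policies (Z l n) U. J' l n \<pi>) + ennreal \<epsilon>"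
    unfolding INF_less_iff by blast
  show ?thesis
  \<comment> \<open>The ranges of \<open>\<pi>\<close> make \<open>\<pi>\<close> itself admissible
    for the restricted infimum.\<close>
  proof (intro exI[of _ "\<lambda>i. \<pi> i ` Z l n i"] conjI allI)
    show "finite (\<pi> i ` Z l n i)" for i
      using finite_Z by simp
    show "\<pi> i ` Z l n i \<subseteq> U i" for i
      using \<pi>(1) by (auto simp: finite_policies_def)
    have "(INF \<pi>'\<in>{\<pi>' \<in> finite_policies (Z l n) U. \<forall>i. \<pi>' i ` Z l n i \<subseteq> \<pi> i ` Z l n i}. J' l n \<pi>')
        \<le> J' l n \<pi>"
      using \<pi>(1) by (intro INF_lower) auto
    then show "(INF \<pi>'\<in>{\<pi>' \<in> finite_policies (Z l n) U. \<forall>i. \<pi>' i ` Z l n i \<subseteq> \<pi> i ` Z l n i}. J' l n \<pi>')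
        < (INF \<pi>\<in>finite_policies (Z l n) U. J' l n \<pi>) + ennreal \<epsilon>"
      using \<pi>(2) by (rule le_less_trans)
  qed
qed

end
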